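(* Assume rewards are Gaussian with known variances, $K$ is a power of $2$, and $n/\log_2K$ is an integer. Then the arm $\hat I$ returned by \texttt{SHVar} satisfies $$\mathbb{P}(\hat I\neq 1)\le 2\log_2K\,\exp\left[-\frac{(n-K\log K)\,\Delta_{\min}^2}{4\sigma_{\max}^2K\log_2K}\right],$$ where $\Delta_{\min}=\mu_1-\mu_2$ and $\sigma_{\max}^2=\max_{i\in\mathcal{A}}\sigma_i^2$.
   Context: Stochastic bandit with arms $\mathcal{A}=[K]$. Each pull of arm $i$ returns an independent $\mathcal{N}(\mu_i,\sigma_i^2)$ reward. Arms are ordered with $\mu_1>\mu_2\ge\dots\ge\mu_K$. $\log$ is the natural logarithm. Sequential-halving meta-algorithm with budget $n$: - There are $m=\lceil\log_2K\rceil$ stages, with $\mathcal{A}_1=\mathcal{A}$ and $n_s=\lfloor n/m\rfloor$. - In stage $s$, for rounds $t=1,\dots,n_s$, the base rule picks $I_{s,t}\in\mathcal{A}_s$, and the reward is observed. - $N_{s,t,i}=\sum_{\ell<t}\mathbb{1}\{I_{s,\ell}=i\}$. - $\hat\mu_{s,i}$ is the average stage-$s$ reward of arm $i$. - $\mathcal{A}_{s+1}$ consists of the $\lceil|\mathcal{A}_s|/2\rceil$ arms with highest $\hat\mu_{s,i}$. - $\hat I$ is the single arm of $\mathcal{A}_{m+1}$. \texttt{SHVar} uses the base rule $I_{s,t}\in\arg\max_{i\in\mathcal{A}_s}\sigma_i^2/N_{s,t,i}$, with the convention $\sigma_i^2/0=+\infty$.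
   Formalization: The formal theorem additionally assumes that the per-stage budget n/log_2 K is at least K, since otherwise some arm is never pulled in the first stage and its average reward, hence the returned arm, is undefined. *)

theory Defs
  imports "HOL-Probability.Probability"
begin

text \<open>Arms are 1..K. sigma i is the standard deviation of arm i, so the variance is sigma i ^ 2.
  Rewards: X (s, i, j) is the reward of the j-th pull (j = 0,1,...) of arm i in stage s
  (stages are numbered 0,...,m-1 here).\<close>

definition shvar_index :: "(nat \<Rightarrow> real) \<Rightarrow> nat \<Rightarrow> nat \<Rightarrow> ereal" where
  "shvar_index \<sigma> i k = (if k = 0 then PInfty else ereal (\<sigma> i ^ 2 / real k))"

text \<open>A (deterministic) selection rule: given the active set and current counts, returns an arm.
  It is an SHVar rule if it always returns an active arm maximising the SHVar index
  (ties broken arbitrarily, as encoded by the function itself).\<close>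
definition shvar_rule :: "(nat \<Rightarrow> real) \<Rightarrow> (nat set \<Rightarrow> (nat \<Rightarrow> nat) \<Rightarrow> nat) \<Rightarrow> bool" where
  "shvar_rule \<sigma> pick \<longleftrightarrow>
     (\<forall>A N. finite A \<and> A \<noteq> {} \<longrightarrow>
        pick A N \<in> A \<and>
        (\<forall>j\<in>A. shvar_index \<sigma> j (N j) \<le> shvar_index \<sigma> (pick A N) (N (pick A N))))"

fun counts :: "(nat set \<Rightarrow> (nat \<Rightarrow> nat) \<Rightarrow> nat) \<Rightarrow> nat set \<Rightarrow> nat \<Rightarrow> nat \<Rightarrow> nat" where
  "counts pick A 0 = (\<lambda>_. 0)"
| "counts pick A (Suc t) =
     (let N = counts pick A t; i = pick A N in N(i := Suc (N i)))"

definition emp_mean :: "(nat \<times> nat \<times> nat \<Rightarrow> 'a \<Rightarrow> real) \<Rightarrow> 'a \<Rightarrow> nat \<Rightarrow> (nat \<Rightarrow> nat) \<Rightarrow> nat \<Rightarrow> real" where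
  "emp_mean X \<omega> s N i = (\<Sum>j<N i. X (s, i, j) \<omega>) / real (N i)"

definition keep_top_half :: "nat set \<Rightarrow> (nat \<Rightarrow> real) \<Rightarrow> nat set" where
  "keep_top_half A v =
     {i \<in> A. card {j \<in> A. v i < v j \<or> (v j = v i \<and> j < i)} < (card A + 1) div 2}"

text \<open>Active sets: active ... 0 = A_1 = {1..K}; active ... (Suc s) = A_{s+2} computed from stage s+1.\<close>
fun active :: "nat \<Rightarrow> nat \<Rightarrow> (nat set \<Rightarrow> (nat \<Rightarrow> nat) \<Rightarrow> nat) \<Rightarrow>
               (nat \<times> nat \<times> nat \<Rightarrow> 'a \<Rightarrow> real) \<Rightarrow> 'a \<Rightarrow> nat \<Rightarrow> nat set" where
  "active K ns pick X \<omega> 0 = {1..K}"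
| "active K ns pick X \<omega> (Suc s) =
     (let A = active K ns pick X \<omega> s; N = counts pick A ns
      in keep_top_half A (emp_mean X \<omega> s N))"

definition sh_output :: "nat \<Rightarrow> nat \<Rightarrow> nat \<Rightarrow> (nat set \<Rightarrow> (nat \<Rightarrow> nat) \<Rightarrow> nat) \<Rightarrow>
               (nat \<times> nat \<times> nat \<Rightarrow> 'a \<Rightarrow> real) \<Rightarrow> 'a \<Rightarrow> nat" where
  "sh_output K m n pick X \<omega> = the_elem (active K (n div m) pick X \<omega> m)"

end

theory Submission
  imports Defs
begin

text \<open>
  Fix a stage with active set \<open>A\<close> of size \<open>k\<close> and per-stage budget \<open>L\<close>, and put
  \<open>w i = \<sigma>\<^sub>i\<^sup>2 / N\<^sub>i\<close>. The empirical means of arms \<open>i\<close> and \<open>1\<close> are swapped with probability at most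
  \<open>exp (- \<Delta>\<^sup>2 / (2 (w i + w 1))) / 2\<close>. The obvious bound \<open>w i \<le> k \<sigma>\<^sub>m\<^sub>a\<^sub>x\<^sup>2 / (L - k)\<close> would only yield
  the theorem with \<open>K log\<^sub>2 K\<close> in place of \<open>K ln K\<close>. To do better, let \<open>\<lambda> = max w\<close> and write
  \<open>N\<^sub>i = \<sigma>\<^sub>i\<^sup>2 / \<lambda> + t\<^sub>i\<close>; the greedy rule forces \<open>0 \<le> t\<^sub>i \<le> 1\<close>. Since the \<open>N\<^sub>i\<close> add up to \<open>L\<close>, at least
  two thirds of the arms have \<open>t\<^sub>i\<close> so large that
  \<open>2 \<sigma>\<^sub>m\<^sub>a\<^sub>x\<^sup>2 / (w i + w 1) \<ge> L / k - 2/3\<close>. If arm \<open>1\<close> is eliminated, at least \<open>k / 2\<close> arms beat it; the factor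
  \<open>1/2\<close> in the Gaussian tail leaves room in Markov's inequality to discard the remaining third of the
  arms, and the stage fails with probability at most
  \<open>2 exp (- \<Delta>\<^sup>2 (L / k - 2/3) / (4 \<sigma>\<^sub>m\<^sub>a\<^sub>x\<^sup>2))\<close>. Finally \<open>2/3 \<le> ln 2\<close>, and
  \<open>(n - K ln K) / (K log\<^sub>2 K) = L / K - ln 2\<close>.
\<close>

subsection \<open>Gaussian comparison of empirical means\<close>

text \<open>Reflection in the origin gives both half-lines the same mass \<open>J\<close>; the
  origin itself is null, so \<open>J + J = 1\<close>.\<close>

lemma nn_integral_normal_density_half:
  assumes "0 < \<sigma>"
  shows "(\<integral>\<^sup>+x. ennreal (normal_density 0 \<sigma> x) * indicator {0..} x \<partial>lborel) = ennreal (1/2)"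
proof -
  define J where "J = (\<integral>\<^sup>+x. ennreal (normal_density 0 \<sigma> x) * indicator {0..} x \<partial>lborel)"
  have "J = (\<integral>\<^sup>+x. ennreal (normal_density 0 \<sigma> x) * indicator {..0} x \<partial>lborel)"
    unfolding J_def
    by (subst nn_integral_real_affine[of _ "-1" 0])
       (auto simp: normal_density_def intro!: nn_integral_cong split: split_indicator)
  also have "\<dots> = (\<integral>\<^sup>+x. ennreal (normal_density 0 \<sigma> x) * indicator {..<0} x \<partial>lborel)"
    by (intro nn_integral_cong_AE AE_I[where N="{0}"]) (auto split: split_indicator)
  finally have J: "J = (\<integral>\<^sup>+x. ennreal (normal_density 0 \<sigma> x) * indicator {..<0} x \<partial>lborel)" .
  have "J + J = (\<integral>\<^sup>+x. ennreal (normal_density 0 \<sigma> x) * indicator {..<0} x \<partial>lborel) + J"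
    by (rule arg_cong2[where f="(+)", OF J refl])
  also have "\<dots> = (\<integral>\<^sup>+x. ennreal (normal_density 0 \<sigma> x) * indicator {..<0} x
                + ennreal (normal_density 0 \<sigma> x) * indicator {0..} x \<partial>lborel)"
    unfolding J_def by (rule nn_integral_add[symmetric]) auto
  also have "\<dots> = (\<integral>\<^sup>+x. ennreal (normal_density 0 \<sigma> x) \<partial>lborel)"
    by (intro nn_integral_cong) (auto split: split_indicator)
  also have "\<dots> = 1"
    using assms by (subst nn_integral_eq_integral) auto
  finally have *: "J + J = 1" .
  then have "J \<noteq> \<top>" by auto
  then obtain r where r: "J = ennreal r" "0 \<le> r"
    by (cases J) auto
  then have "ennreal (r + r) = ennreal 1"
    using * by (simp only: ennreal_plus) simp
  then have "r = 1/2"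
    using r by (subst (asm) ennreal_inj) auto
  then show ?thesis using r by (simp only: J_def)
qed

text \<open>For \<open>x \<ge> 0 \<ge> \<mu>\<close> the cross term has the sign that makes
  \<open>(x - \<mu>)\<^sup>2 \<ge> \<mu>\<^sup>2 + x\<^sup>2\<close>. So the density is at most the
  exponential factor times the centred density, whose mass on the half-line is 1/2. A Chernoff bound
  would lose this 1/2.\<close>

lemma (in prob_space) normal_upper_tail_le:
  assumes D: "distributed M lborel X (normal_density \<mu> \<sigma>)" and "0 < \<sigma>" "\<mu> \<le> 0"
  shows "prob {\<omega> \<in> space M. 0 \<le> X \<omega>} \<le> exp (- (\<mu>\<^sup>2 / (2 * \<sigma>\<^sup>2))) / 2"
proof -
  let ?e = "exp (- (\<mu>\<^sup>2 / (2 * \<sigma>\<^sup>2)))"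
  have dens: "normal_density \<mu> \<sigma> x \<le> ?e * normal_density 0 \<sigma> x" if "0 \<le> x" for x
  proof -
    have "x * \<mu> \<le> 0" using that \<open>\<mu> \<le> 0\<close> by (rule mult_nonneg_nonpos)
    then have "\<mu>\<^sup>2 + x\<^sup>2 \<le> (x - \<mu>)\<^sup>2" by (simp add: power2_eq_square algebra_simps)
    then have "(\<mu>\<^sup>2 + x\<^sup>2) / (2 * \<sigma>\<^sup>2) \<le> (x - \<mu>)\<^sup>2 / (2 * \<sigma>\<^sup>2)"
      by (intro divide_right_mono) auto
    then have "exp (- ((x - \<mu>)\<^sup>2 / (2 * \<sigma>\<^sup>2))) \<le> ?e * exp (- (x\<^sup>2 / (2 * \<sigma>\<^sup>2)))"
      by (simp add: mult_exp_exp add_divide_distrib)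
    then show ?thesis
      by (simp add: normal_density_def divide_right_mono)
  qed
  have "emeasure M (X -` {0..} \<inter> space M)
        = (\<integral>\<^sup>+x. ennreal (normal_density \<mu> \<sigma> x) * indicator {0..} x \<partial>lborel)"
    by (rule distributed_emeasure[OF D]) auto
  also have "\<dots> \<le> (\<integral>\<^sup>+x. ennreal ?e * (ennreal (normal_density 0 \<sigma> x) * indicator {0..} x) \<partial>lborel)"
    by (intro nn_integral_mono)
       (auto split: split_indicator simp: ennreal_mult[symmetric] intro!: ennreal_leI dens)
  also have "\<dots> = ennreal ?e * ennreal (1/2)"
    using \<open>0 < \<sigma>\<close> by (subst nn_integral_cmult) (auto simp: nn_integral_normal_density_half)
  also have "\<dots> = ennreal (?e / 2)"
    by (subst ennreal_mult[symmetric]) auto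
  finally have "emeasure M (X -` {0..} \<inter> space M) \<le> ennreal (?e / 2)" .
  moreover have "X -` {0..} \<inter> space M = {\<omega> \<in> space M. 0 \<le> X \<omega>}" by auto
  ultimately show ?thesis
    by (simp add: emeasure_eq_measure)
qed

lemma sum_two_arm_indices:
  fixes a b p q s :: nat
  assumes "a \<noteq> b"
  defines "I \<equiv> (\<lambda>j. (s, a, j)) ` {..<p} \<union> (\<lambda>j. (s, b, j)) ` {..<q}"
  shows "(\<Sum>x\<in>I. (f x :: real)) = (\<Sum>j<p. f (s, a, j)) + (\<Sum>j<q. f (s, b, j))"
  unfolding I_def using assms
  by (subst sum.union_disjoint) (auto simp: sum.reindex inj_on_def)

text \<open>The difference of the two means is a linear combination of independent Gaussians, hence
  Gaussian with mean \<open>\<mu> a - \<mu> b \<le> 0\<close>, and the tail bound at 0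
  applies.\<close>

lemma (in prob_space) normal_mean_comparison:
  fixes X :: "nat \<times> nat \<times> nat \<Rightarrow> 'a \<Rightarrow> real"
  assumes indep: "indep_vars (\<lambda>_. borel) X (UNIV \<times> B \<times> UNIV)"
    and ab: "a \<in> B" "b \<in> B" "a \<noteq> b"
    and gauss: "\<And>i j. i \<in> B \<Longrightarrow> distributed M lborel (X (s, i, j)) (normal_density (\<mu> i) (\<sigma> i))"
    and pos: "\<And>i. i \<in> B \<Longrightarrow> 0 < \<sigma> i" and N: "0 < N a" "0 < N b" and le: "\<mu> a \<le> \<mu> b"
  shows "prob {\<omega> \<in> space M. emp_mean X \<omega> s N b \<le> emp_mean X \<omega> s N a}
    \<le> exp (- ((\<mu> b - \<mu> a)\<^sup>2 / (2 * ((\<sigma> a)\<^sup>2 / N a + (\<sigma> b)\<^sup>2 / N b)))) / 2"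
proof -
  define I where "I = (\<lambda>j. (s, a, j)) ` {..<N a} \<union> (\<lambda>j. (s, b, j)) ` {..<N b}"
  note sum_I = sum_two_arm_indices[OF \<open>a \<noteq> b\<close>, of _ s "N a" "N b", folded I_def]
  define c where "c = (\<lambda>(_ :: nat, i, _ :: nat). if i = a then 1 / real (N a) else - (1 / real (N b)))"
  \<comment> \<open>The shift by 0, here and in \<open>m\<close>, and the absolute value in
    \<open>d\<close> match the shape of \<open>normal_density_affine\<close>.\<close>
  let ?Y = "\<lambda>x \<omega>. 0 + c x * X x \<omega>"
  define m where "m x = 0 + c x * \<mu> (fst (snd x))" for x
  define d where "d x = \<bar>c x\<bar> * \<sigma> (fst (snd x))" for x
  have c0: "c x \<noteq> 0" for x using N by (cases x) (auto simp: c_def)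
  have IB: "I \<subseteq> UNIV \<times> B \<times> UNIV" using ab by (auto simp: I_def)
  have "distributed M lborel (\<lambda>\<omega>. \<Sum>x\<in>I. ?Y x \<omega>)
      (normal_density (\<Sum>x\<in>I. m x) (sqrt (\<Sum>x\<in>I. (d x)\<^sup>2)))"
  proof (rule sum_indep_normal)
    show "finite I" "I \<noteq> {}" using N by (auto simp: I_def)
    show "indep_vars (\<lambda>i. borel) ?Y I"
      by (rule indep_vars_compose2[OF indep_vars_subset[OF indep IB]]) auto
    show "0 < d x" if "x \<in> I" for x
      unfolding d_def using that IB pos c0[of x] by auto
    show "distributed M lborel (?Y x) (normal_density (m x) (d x))" if "x \<in> I" for x
      unfolding d_def m_def using that IB c0[of x]
      by (intro normal_density_affine) (auto intro!: gauss pos simp: I_def ab)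
  qed
  moreover have "(\<Sum>x\<in>I. ?Y x \<omega>) = emp_mean X \<omega> s N a - emp_mean X \<omega> s N b" for \<omega>
    using ab by (simp add: sum_I c_def emp_mean_def sum_divide_distrib sum_negf)
  moreover have "(\<Sum>x\<in>I. m x) = \<mu> a - \<mu> b"
    using ab N by (simp add: sum_I c_def m_def)
  moreover have "(\<Sum>x\<in>I. (d x)\<^sup>2) = (\<sigma> a)\<^sup>2 / N a + (\<sigma> b)\<^sup>2 / N b"
    using ab N by (simp add: sum_I c_def d_def power_mult_distrib power2_eq_square)
  ultimately have D: "distributed M lborel (\<lambda>\<omega>. emp_mean X \<omega> s N a - emp_mean X \<omega> s N b)
      (normal_density (\<mu> a - \<mu> b) (sqrt ((\<sigma> a)\<^sup>2 / N a + (\<sigma> b)\<^sup>2 / N b)))"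
    by simp
  have v: "0 < (\<sigma> a)\<^sup>2 / N a + (\<sigma> b)\<^sup>2 / N b"
    using N pos[OF ab(1)] pos[OF ab(2)] by (intro add_pos_pos) auto
  show ?thesis
    using normal_upper_tail_le[OF D] v le by (simp add: power2_commute)
qed

subsection \<open>The SHVar allocation\<close>

context
  fixes \<sigma> :: "nat \<Rightarrow> real" and pick :: "nat set \<Rightarrow> (nat \<Rightarrow> nat) \<Rightarrow> nat" and A :: "nat set"
  assumes rule: "shvar_rule \<sigma> pick" and A: "finite A" "A \<noteq> {}"
    and pos: "\<And>i. i \<in> A \<Longrightarrow> 0 < \<sigma> i"
begin

lemma pick_in: "pick A N \<in> A"
  and pick_max: "j \<in> A \<Longrightarrow> shvar_index \<sigma> j (N j) \<le> shvar_index \<sigma> (pick A N) (N (pick A N))"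
  using rule A unfolding shvar_rule_def by blast+

lemma shvar_index_Suc_le: "shvar_index \<sigma> i (Suc k) \<le> shvar_index \<sigma> i k"
  by (auto simp: shvar_index_def intro!: divide_left_mono)

lemma sum_counts: "(\<Sum>i\<in>A. counts pick A t i) = t"
proof (induction t)
  case (Suc t)
  let ?N = "counts pick A t" and ?p = "pick A (counts pick A t)"
  have "(\<Sum>i\<in>A. (?N(?p := Suc (?N ?p))) i) = (\<Sum>i\<in>A. ?N i + (if i = ?p then 1 else 0))"
    by (intro sum.cong) auto
  then show ?case
    using Suc pick_in A by (simp add: Let_def sum.distrib)
qed simp

text \<open>Just before its last pull, arm \<open>j\<close> had one pull fewer and maximal index;
  since then the index of \<open>i\<close> can only have dropped.\<close>

lemma counts_balanced:
  "\<lbrakk>i \<in> A; j \<in> A; 0 < counts pick A t j\<rbrakk>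
    \<Longrightarrow> shvar_index \<sigma> i (counts pick A t i) \<le> shvar_index \<sigma> j (counts pick A t j - 1)"
proof (induction t arbitrary: i j)
  case (Suc t)
  let ?N = "counts pick A t" and ?p = "pick A (counts pick A t)"
  have le: "shvar_index \<sigma> i (counts pick A (Suc t) i) \<le> shvar_index \<sigma> i (?N i)"
    using shvar_index_Suc_le by (auto simp: Let_def)
  show ?case
  proof (cases "j = ?p")
    case True
    then show ?thesis using le pick_max[OF Suc.prems(1), of ?N] by (simp add: Let_def)
  next
    case False
    then show ?thesis using le Suc.IH[OF Suc.prems(1,2)] Suc.prems(3) by (simp add: Let_def)
  qed
qed simp

text \<open>An unpulled arm has index infinity, so by balance no arm was pulled twice; the counts
  then add up to less than \<open>card A\<close>.\<close>

lemma counts_pos: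
  assumes "card A \<le> t" "i \<in> A"
  shows "0 < counts pick A t i"
proof (rule ccontr)
  assume "\<not> ?thesis"
  then have i: "counts pick A t i = 0" by simp
  have le1: "counts pick A t j \<le> 1" if "j \<in> A" for j
  proof (rule ccontr)
    assume "\<not> ?thesis"
    then have "shvar_index \<sigma> i (counts pick A t i) \<le> shvar_index \<sigma> j (counts pick A t j - 1)"
      using counts_balanced[OF assms(2) that] by simp
    with i \<open>\<not> counts pick A t j \<le> 1\<close> show False by (simp add: shvar_index_def)
  qed
  have "(\<Sum>j\<in>A. counts pick A t j) < (\<Sum>j\<in>A. 1)"
    using A le1 assms(2) i by (intro sum_strict_mono_ex1) auto
  then show False using assms(1) by (simp add: sum_counts)
qed

text \<open>Balance in cross-multiplied form, which also covers \<open>N j = 1\<close>, where the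
  earlier index of \<open>j\<close> is infinite.\<close>

lemma counts_ratio:
  assumes "card A \<le> t" "i \<in> A" "j \<in> A"
  shows "(\<sigma> i)\<^sup>2 * (real (counts pick A t j) - 1) \<le> (\<sigma> j)\<^sup>2 * counts pick A t i"
proof -
  let ?N = "counts pick A t"
  have N: "0 < ?N i" "0 < ?N j" using counts_pos assms by auto
  show ?thesis
  proof (cases "?N j = 1")
    case False
    then have "(\<sigma> i)\<^sup>2 / ?N i \<le> (\<sigma> j)\<^sup>2 / (?N j - 1)"
      using N counts_balanced[OF assms(2,3), of t] by (simp add: shvar_index_def)
    then show ?thesis using N False by (simp add: field_simps of_nat_diff)
  qed simp
qed

end

text \<open>The deterministic core: \<open>a\<close> stands for the variances, \<open>N\<close> for
  the pull counts and \<open>c\<close> for the best arm. An imprecise arm has a small rounding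
  surplus \<open>t\<close>, and the fixed total of \<open>N\<close> leaves room for few of
  those.\<close>

lemma few_imprecise_arms:
  fixes a N :: "'i \<Rightarrow> real" and S :: real
  assumes fin: "finite A" and c: "c \<in> A"
    and a: "\<And>i. i \<in> A \<Longrightarrow> 0 < a i" "\<And>i. i \<in> A \<Longrightarrow> a i \<le> S"
    and N: "\<And>i. i \<in> A \<Longrightarrow> 1 \<le> N i"
    and ratio: "\<And>i j. i \<in> A \<Longrightarrow> j \<in> A \<Longrightarrow> a i * (N j - 1) \<le> a j * N i"
  shows "3 * card {j \<in> A. 2 * S < (sum N A / card A - 2/3) * (a j / N j + a c / N c)} \<le> card A"
proof -
  define k where "k = real (card A)"
  have k: "0 < k" using fin c by (auto simp: k_def card_gt_0_iff)
  define l where "l = Max ((\<lambda>i. a i / N i) ` A)"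
  have l_ge: "a i / N i \<le> l" if "i \<in> A" for i
    unfolding l_def using fin that by auto
  have "l \<in> (\<lambda>i. a i / N i) ` A" unfolding l_def using fin c by (intro Max_in) auto
  then obtain z where z: "z \<in> A" "l = a z / N z" by auto
  have l: "0 < l" using z a(1)[OF z(1)] N[OF z(1)] by simp
  have S: "0 < S" using a[OF c] by simp
  \<comment> \<open>The unrounded count of an arm of variance \<open>S\<close> whose index is
    exactly \<open>l\<close>. That \<open>q \<ge> 1\<close> is used in \<open>key\<close>.\<close>
  define q where "q = S / l"
  have "a z / N z \<le> a z / 1" using a(1)[OF z(1)] N[OF z(1)] by (intro divide_left_mono) auto
  then have "l \<le> S" using z a(2)[OF z(1)] by simp
  then have q: "1 \<le> q" using l by (simp add: q_def)
  define t where "t j = N j - a j / l" for j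
  have t0: "0 \<le> t j" if "j \<in> A" for j
    using l_ge[OF that] l N[OF that] by (simp add: t_def field_simps)
  \<comment> \<open>\<open>ratio\<close> against the arm \<open>z\<close> of maximal index
    \<open>l\<close> reads \<open>N j - 1 \<le> a j / l\<close>.\<close>
  have t1: "t j \<le> 1" if "j \<in> A" for j
    using ratio[OF z(1) that] a(1)[OF z(1)] N[OF z(1)] by (simp add: t_def z(2) field_simps)
  define R where "R = sum N A / k - 2/3"
  \<comment> \<open>Chosen so that \<open>h \<le> t j\<close> means
    \<open>R \<le> q + t j / 3\<close>. The coefficient 1/3 is the largest for which
    \<open>key\<close> holds at \<open>q = t j = 1\<close>.\<close>
  define h where "h = 3 * (R - q)"
  define B where "B = {j \<in> A. t j < h}"
  have finB: "finite B" "B \<subseteq> A" using fin by (auto simp: B_def)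
  have good: "R * (a j / N j + a c / N c) \<le> 2 * S" if j: "j \<in> A" and "h \<le> t j" for j
  proof -
    have "a j * t j \<le> S * t j" using a(2)[OF j] t0[OF j] by (rule mult_right_mono)
    then have "a j * (q + t j) \<le> S * N j"
      using l by (simp add: t_def q_def algebra_simps)
    then have w: "a j / N j \<le> S / (q + t j)"
      using N[OF j] q t0[OF j] by (simp add: field_simps)
    \<comment> \<open>Here \<open>S / q\<close> is just \<open>l\<close>: no rounding gain is
      claimed for the best arm.\<close>
    have wo: "a c / N c \<le> S / q" using l_ge[OF c] l S by (simp add: q_def)
    have "t j * t j \<le> q * t j" using t0[OF j] t1[OF j] q by (intro mult_right_mono) auto
    then have key: "(q + t j / 3) * (2 * q + t j) \<le> 2 * (q * (q + t j))"
      by (simp add: algebra_simps)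
    have "R * (a j / N j + a c / N c) \<le> (q + t j / 3) * (a j / N j + a c / N c)"
      using that a(1)[OF j] a(1)[OF c] N[OF j] N[OF c] by (intro mult_right_mono) (auto simp: h_def)
    also have "\<dots> \<le> (q + t j / 3) * (S / (q + t j) + S / q)"
      using w wo q t0[OF j] by (intro mult_left_mono) auto
    also have "\<dots> = S * ((q + t j / 3) * (2 * q + t j)) / (q * (q + t j))"
      using q t0[OF j] by (simp add: divide_simps) (simp add: algebra_simps)
    also have "\<dots> \<le> S * (2 * (q * (q + t j))) / (q * (q + t j))"
      using key S q t0[OF j] by (intro divide_right_mono mult_left_mono) auto
    also have "\<dots> = 2 * S"
    proof -
      have "q * (q + t j) \<noteq> 0" using q t0[OF j] by simp
      then show ?thesis by (metis mult.assoc mult.commute nonzero_mult_div_cancel_right)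
    qed
    finally show ?thesis .
  qed
  \<comment> \<open>Average of \<open>t\<close>: the budget forces at least \<open>2/3 + h/3\<close>, while more than \<open>k/3\<close> values below \<open>h\<close>
    and the others at most \<open>1\<close> would keep it strictly below that.\<close>
  have "3 * card B \<le> card A"
  proof (rule ccontr)
    assume "\<not> ?thesis"
    then have b: "k < 3 * real (card B)" by (simp add: k_def)
    then have "B \<noteq> {}" using k by auto
    have "sum N A = (\<Sum>j\<in>A. a j / l) + sum t A" by (simp add: t_def sum_subtractf)
    moreover have "(\<Sum>j\<in>A. a j / l) \<le> (\<Sum>j\<in>A. q)"
      using a l by (intro sum_mono) (auto simp: q_def divide_right_mono)
    ultimately have NA: "sum N A \<le> k * q + sum t A" by (simp add: k_def)
    have RL: "sum N A = k * (h / 3 + 2/3 + q)"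
      using k by (simp add: h_def R_def field_simps)
    have "sum t B < (\<Sum>j\<in>B. h)"
      using finB \<open>B \<noteq> {}\<close> by (intro sum_strict_mono) (auto simp: B_def)
    moreover have "sum t (A - B) \<le> (\<Sum>j\<in>A-B. 1)" by (intro sum_mono) (auto simp: t1)
    moreover have "real (card (A - B)) = k - card B"
      using fin finB by (simp add: card_Diff_subset k_def of_nat_diff card_mono)
    moreover have "sum t A = sum t (A - B) + sum t B"
      using fin finB by (intro sum.subset_diff)
    ultimately have "sum t A < k - card B + card B * h" by simp
    \<comment> \<open>After cancelling \<open>k * q\<close>, the bounds read
      \<open>k * (h + 2) / 3 < k - card B + card B * h\<close>, which factors because of the
      constant 2/3. It forces \<open>h > 1\<close>, against the plain average of
      \<open>t \<le> 1\<close>.\<close>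
    with NA RL have "0 < (card B - k / 3) * (h - 1)"
      by (simp add: algebra_simps diff_divide_distrib)
    then have "1 < h" using b by (simp add: zero_less_mult_iff)
    moreover have "sum t A \<le> (\<Sum>j\<in>A. 1)" by (intro sum_mono) (auto simp: t1)
    then have "k * (h / 3 + 2/3) \<le> k * 1" using NA RL by (simp add: k_def algebra_simps)
    then have "h \<le> 1" using k by simp
    ultimately show False by simp
  qed
  moreover have "card {j \<in> A. 2 * S < R * (a j / N j + a c / N c)} \<le> card B"
    using good finB by (intro card_mono) (force simp: B_def)+
  ultimately show ?thesis by (simp add: R_def k_def)
qed

text \<open>With ties broken by index, "beats" is a strict linear order, so the rank is injective on
  \<open>A\<close> and takes each value below \<open>card A\<close> exactly once.\<close>

lemma card_rank_less:
  fixes v :: "'i :: linorder \<Rightarrow> real"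
  assumes "finite A" "r \<le> card A"
  shows "card {i \<in> A. card {j \<in> A. v i < v j \<or> (v j = v i \<and> j < i)} < r} = r"
proof -
  define b where "b i j \<longleftrightarrow> v i < v j \<or> (v j = v i \<and> j < i)" for i j
  define rk where "rk i = card {j \<in> A. b i j}" for i
  have less: "rk j < rk i" if "b i j" "i \<in> A" "j \<in> A" for i j
    unfolding rk_def using that assms(1) by (intro psubset_card_mono) (auto simp: b_def)
  have inj: "inj_on rk A"
  proof (rule inj_onI, rule ccontr)
    fix i j assume *: "i \<in> A" "j \<in> A" "rk i = rk j" "i \<noteq> j"
    then have "b i j \<or> b j i" by (auto simp: b_def)
    then show False using less * by force
  qed
  have "rk i < card A" if "i \<in> A" for i
    unfolding rk_def using that assms(1) by (intro psubset_card_mono) (auto simp: b_def)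
  then have "rk ` A = {..<card A}"
    using inj by (intro card_subset_eq) (auto simp: card_image)
  then have "rk ` {i \<in> A. rk i < r} = {..<r}"
    using assms(2) by (auto simp: image_iff set_eq_iff) (metis order_less_le_trans)
  moreover have "inj_on rk {i \<in> A. rk i < r}" using inj by (rule inj_on_subset) auto
  ultimately have "card {i \<in> A. rk i < r} = r" by (metis card_image card_lessThan)
  then show ?thesis by (simp add: rk_def b_def)
qed

subsection \<open>Elimination\<close>

lemma card_filter_eq_sum:
  "finite B \<Longrightarrow> real (card {j \<in> B. P j}) = (\<Sum>j\<in>B. if P j then 1 else 0)"
  by (simp add: sum.If_cases Int_def)

lemma keep_top_half_subset: "keep_top_half A v \<subseteq> A"
  by (auto simp: keep_top_half_def)

lemma keep_top_half_cong:
  assumes "\<And>i. i \<in> A \<Longrightarrow> v i = w i"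
  shows "keep_top_half A v = keep_top_half A w"
proof -
  have "{j \<in> A. v i < v j \<or> (v j = v i \<and> j < i)} = {j \<in> A. w i < w j \<or> (w j = w i \<and> j < i)}"
    if "i \<in> A" for i using assms that by auto
  then show ?thesis by (auto simp: keep_top_half_def)
qed

lemma card_keep_top_half: "finite A \<Longrightarrow> card (keep_top_half A v) = (card A + 1) div 2"
  unfolding keep_top_half_def by (rule card_rank_less) auto

section \<open>Measurability and size of the active sets\<close>

lemma measurable_mem_keep_top_half:
  assumes "finite B" and v: "\<And>i. i \<in> B \<Longrightarrow> (\<lambda>\<omega>. v \<omega> i) \<in> borel_measurable M"
  shows "Measurable.pred M (\<lambda>\<omega>. i \<in> keep_top_half B (v \<omega>))"
proof (cases "i \<in> B")
  case True
  note v[OF True, measurable]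
  \<comment> \<open>The cardinality of a random set becomes a finite sum of indicators, which is
    visibly measurable.\<close>
  have "i \<in> keep_top_half B (v \<omega>) \<longleftrightarrow>
      (\<Sum>j\<in>B. if v \<omega> i < v \<omega> j \<or> (v \<omega> j = v \<omega> i \<and> j < i) then 1 else 0) < real ((card B + 1) div 2)" for \<omega>
    using True assms(1) by (simp add: keep_top_half_def card_filter_eq_sum[symmetric])
  moreover have "(\<lambda>\<omega>. if v \<omega> i < v \<omega> j \<or> (v \<omega> j = v \<omega> i \<and> j < i) then 1 else 0 :: real)
      \<in> borel_measurable M" if "j \<in> B" for j
  proof -
    note v[OF that, measurable]
    show ?thesis by measurable
  qed
  then have [measurable]: "(\<lambda>\<omega>. \<Sum>j\<in>B. if v \<omega> i < v \<omega> j \<or> (v \<omega> j = v \<omega> i \<and> j < i) then 1 else 0 :: real)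
      \<in> borel_measurable M"
    by (rule borel_measurable_sum)
  ultimately show ?thesis by simp
next
  case False
  then show ?thesis using keep_top_half_subset by (simp add: keep_top_half_def)
qed

lemma measurable_keep_top_half_eq:
  assumes "finite B" and v: "\<And>i. i \<in> B \<Longrightarrow> (\<lambda>\<omega>. v \<omega> i) \<in> borel_measurable M"
  shows "Measurable.pred M (\<lambda>\<omega>. keep_top_half B (v \<omega>) = A)"
proof (cases "A \<subseteq> B")
  case True
  note measurable_mem_keep_top_half[OF assms, measurable]
  have "keep_top_half B (v \<omega>) = A \<longleftrightarrow> (\<forall>i\<in>B. i \<in> keep_top_half B (v \<omega>) \<longleftrightarrow> i \<in> A)" for \<omega>
    using True keep_top_half_subset by blast
  moreover have "Measurable.pred M (\<lambda>\<omega>. \<forall>i\<in>B. i \<in> keep_top_half B (v \<omega>) \<longleftrightarrow> i \<in> A)"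
    using assms(1) by measurable
  ultimately show ?thesis by simp
next
  case False
  then have "keep_top_half B (v \<omega>) \<noteq> A" for \<omega> using keep_top_half_subset by blast
  then show ?thesis by simp
qed

lemma measurable_emp_mean:
  assumes "\<And>j. X (s, i, j) \<in> borel_measurable M"
  shows "(\<lambda>\<omega>. emp_mean X \<omega> s N i) \<in> borel_measurable M"
  unfolding emp_mean_def using assms by measurable

lemma active_subset: "active K L pick X \<omega> s \<subseteq> {1..K}"
proof (induction s)
  case (Suc s)
  then show ?case using keep_top_half_subset by (simp add: Let_def) blast
qed simp

lemma card_active:
  assumes "K = 2 ^ m" "s \<le> m"
  shows "card (active K L pick X \<omega> s) = 2 ^ (m - s)"
  using assms(2)
proof (induction s)
  case (Suc s)
  \<comment> \<open>Shows that the current size is even, so that rounding up in the halving has no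
    effect.\<close>
  have "m - s = Suc (m - Suc s)" using Suc.prems by simp
  then show ?case
    using Suc finite_subset[OF active_subset[of K L pick X \<omega> s]]
    by (simp add: Let_def card_keep_top_half)
qed (simp add: assms)

text \<open>Allows the rewards to be replaced by their restriction to earlier stages, as coordinates
  on a product space.\<close>

lemma active_cong:
  assumes "\<And>s' i j. s' < s \<Longrightarrow> i \<in> {1..K} \<Longrightarrow> X (s', i, j) \<omega> = Y (s', i, j) \<omega>'"
  shows "active K L pick X \<omega> s = active K L pick Y \<omega>' s"
  using assms
proof (induction s)
  case (Suc s)
  then have IH: "active K L pick X \<omega> s = active K L pick Y \<omega>' s" by simp
  have "emp_mean X \<omega> s N i = emp_mean Y \<omega>' s N i" if "i \<in> active K L pick Y \<omega>' s" for i N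
  proof -
    have "i \<in> {1..K}" using that active_subset[of K L pick Y \<omega>' s] by blast
    then show ?thesis using Suc.prems[of s i] by (simp add: emp_mean_def)
  qed
  then show ?case by (auto simp: Let_def IH intro!: keep_top_half_cong)
qed simp

lemma measurable_active_eq:
  assumes "\<And>s' i j. s' < s \<Longrightarrow> i \<in> {1..K} \<Longrightarrow> X (s', i, j) \<in> borel_measurable M"
  shows "Measurable.pred M (\<lambda>\<omega>. active K L pick X \<omega> s = A)"
  using assms
proof (induction s arbitrary: A)
  case (Suc s)
  have [measurable]: "Measurable.pred M (\<lambda>\<omega>. active K L pick X \<omega> s = B)" for B
    using Suc by simp
  \<comment> \<open>The pull counts are random only through the active set; for each of the finitely
    many candidates \<open>B\<close> they are constants.\<close>
  have "Measurable.pred M (\<lambda>\<omega>. keep_top_half B (emp_mean X \<omega> s (counts pick B L)) = A)"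
    if "B \<in> Pow {1..K}" for B
    using that Suc.prems
    by (intro measurable_keep_top_half_eq measurable_emp_mean) (auto intro: finite_subset)
  then have "Measurable.pred M (\<lambda>\<omega>. \<exists>B\<in>Pow {1..K}. active K L pick X \<omega> s = B \<and>
      keep_top_half B (emp_mean X \<omega> s (counts pick B L)) = A)"
    by (intro pred_intros_finite) auto
  moreover have "active K L pick X \<omega> (Suc s) = A \<longleftrightarrow> (\<exists>B\<in>Pow {1..K}. active K L pick X \<omega> s = B \<and>
      keep_top_half B (emp_mean X \<omega> s (counts pick B L)) = A)" for \<omega>
    using active_subset[of K L pick X \<omega> s] by (auto simp: Let_def)
  ultimately show ?case by simp
qed simp

lemma measurable_mem_active:
  assumes "\<And>s i j. i \<in> {1..K} \<Longrightarrow> X (s, i, j) \<in> borel_measurable M"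
  shows "Measurable.pred M (\<lambda>\<omega>. i \<in> active K L pick X \<omega> s)"
proof -
  have [measurable]: "Measurable.pred M (\<lambda>\<omega>. active K L pick X \<omega> s = A)" for A
    using assms by (rule measurable_active_eq)
  have "Measurable.pred M (\<lambda>\<omega>. \<exists>A\<in>{A \<in> Pow {1..K}. i \<in> A}. active K L pick X \<omega> s = A)"
    by (intro pred_intros_finite) auto
  moreover have "(\<exists>A\<in>{A \<in> Pow {1..K}. i \<in> A}. active K L pick X \<omega> s = A)
      \<longleftrightarrow> i \<in> active K L pick X \<omega> s" for \<omega>
    using active_subset[of K L pick X \<omega> s] by auto
  ultimately show ?thesis by simp
qed

section \<open>Failure probability of one stage and of the whole run\<close>

locale shvar_bandit = prob_space M for M :: "'a measure" +
  fixes X :: "nat \<times> nat \<times> nat \<Rightarrow> 'a \<Rightarrow> real"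
    and K L :: nat and \<mu> \<sigma> :: "nat \<Rightarrow> real" and S D :: real
    and pick :: "nat set \<Rightarrow> (nat \<Rightarrow> nat) \<Rightarrow> nat"
  assumes indep: "indep_vars (\<lambda>_. borel) X (UNIV \<times> {1..K} \<times> UNIV)"
    and gauss: "\<And>s i j. i \<in> {1..K} \<Longrightarrow>
                  distributed M lborel (X (s, i, j)) (normal_density (\<mu> i) (\<sigma> i))"
    and sigma_pos: "\<And>i. i \<in> {1..K} \<Longrightarrow> \<sigma> i > 0"
    and var_le: "\<And>i. i \<in> {1..K} \<Longrightarrow> (\<sigma> i)\<^sup>2 \<le> S"
    and gap: "\<And>i. i \<in> {2..K} \<Longrightarrow> \<mu> i + D \<le> \<mu> 1" and gap_nonneg: "0 \<le> D"
    and budget: "K \<le> L"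
    and rule: "shvar_rule \<sigma> pick"
begin

lemma measurable_reward: "i \<in> {1..K} \<Longrightarrow> X (s, i, j) \<in> borel_measurable M"
  using distributed_measurable[OF gauss] by simp

lemma measurable_stage_mean:
  "i \<in> {1..K} \<Longrightarrow> (\<lambda>\<omega>. emp_mean X \<omega> s N i) \<in> borel_measurable M"
  by (intro measurable_emp_mean measurable_reward)

text \<open>\<open>A\<close> is a fixed set rather than the random active set, so the event depends
  on the rewards of stage \<open>s\<close> only.\<close>

definition best_elim :: "nat \<Rightarrow> nat set \<Rightarrow> 'a set" where
  "best_elim s A = {\<omega> \<in> space M. 1 \<notin> keep_top_half A (emp_mean X \<omega> s (counts pick A L))}"

lemma sets_best_elim: "A \<subseteq> {1..K} \<Longrightarrow> best_elim s A \<in> sets M"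
proof -
  assume A: "A \<subseteq> {1..K}"
  have [measurable]: "Measurable.pred M (\<lambda>\<omega>. 1 \<in> keep_top_half A (emp_mean X \<omega> s (counts pick A L)))"
    using A by (intro measurable_mem_keep_top_half measurable_stage_mean) (auto intro: finite_subset)
  show ?thesis unfolding best_elim_def by measurable
qed

text \<open>Markov's inequality for the number of precise arms in \<open>G\<close> that reach the
  mean of arm 1: elimination requires at least \<open>k / 2 - b\<close> of them, where
  \<open>b\<close> counts the discarded arms.\<close>

lemma prob_best_elim_le:
  assumes A: "A \<subseteq> {1..K}" "1 \<in> A" and ev: "even (card A)"
  shows "prob (best_elim s A) \<le> 2 * exp (- (D\<^sup>2 / (4 * S) * (L / card A - 2/3)))"
proof -
  define N where "N = counts pick A L"
  define k where "k = card A"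
  define w where "w i = (\<sigma> i)\<^sup>2 / N i" for i
  define R where "R = L / k - 2/3"
  define bad where "bad = {j \<in> A. 2 * S < R * (w j + w 1)}"
  define G where "G = A - insert 1 bad"
  \<comment> \<open>The Gaussian exponent with gap \<open>D\<close> and with
    \<open>w j + w 1\<close> replaced by its bound \<open>2 * S / R\<close>.\<close>
  define e where "e = exp (- (D\<^sup>2 / (4 * S) * R))"
  define E where "E j = {\<omega> \<in> space M. emp_mean X \<omega> s N 1 \<le> emp_mean X \<omega> s N j}" for j
  have fin: "finite A" "A \<noteq> {}" using A by (auto intro: finite_subset)
  have posA: "\<And>i. i \<in> A \<Longrightarrow> 0 < \<sigma> i" using A sigma_pos by auto
  have k0: "0 < k" using fin by (auto simp: k_def card_gt_0_iff)
  have kL: "k \<le> L" using card_mono[OF _ A(1)] budget by (simp add: k_def)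
  have Npos: "0 < N i" if "i \<in> A" for i
    unfolding N_def using counts_pos[OF rule fin posA _ that] kL by (simp add: k_def)
  have sumN: "(\<Sum>i\<in>A. real (N i)) = L"
    using sum_counts[OF rule fin posA, of L] unfolding N_def by (metis of_nat_sum)
  have "3 * card {j \<in> A. 2 * S < ((\<Sum>i\<in>A. real (N i)) / card A - 2/3) *
      ((\<sigma> j)\<^sup>2 / N j + (\<sigma> 1)\<^sup>2 / N 1)} \<le> card A"
  proof (rule few_imprecise_arms)
    show "(\<sigma> i)\<^sup>2 * (real (N j) - 1) \<le> (\<sigma> j)\<^sup>2 * real (N i)" if "i \<in> A" "j \<in> A" for i j
      unfolding N_def using counts_ratio[OF rule fin posA _ that] kL by (simp add: k_def)
    show "0 < (\<sigma> i)\<^sup>2" if "i \<in> A" for i using posA[OF that] by simp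
    show "1 \<le> real (N i)" if "i \<in> A" for i using Npos[OF that] by simp
  qed (use fin A var_le in auto)
  then have bad: "3 * card bad \<le> k"
    unfolding sumN bad_def R_def w_def k_def .
  have R: "0 \<le> R" using kL k0 by (simp add: R_def field_simps)
  have S: "0 < S" using less_le_trans[OF zero_less_power[OF posA[OF A(2)]] var_le[of 1]] A by auto
  have E_le: "prob (E j) \<le> e / 2" if j: "j \<in> G" for j
  proof -
    have jA: "j \<in> A" "j \<noteq> 1" "j \<in> {2..K}" using j A by (auto simp: G_def subset_iff)
    have g: "D \<le> \<mu> 1 - \<mu> j" using gap[OF jA(3)] by simp
    have wpos: "0 < w j + w 1"
      using posA[OF jA(1)] posA[OF A(2)] Npos[OF jA(1)] Npos[OF A(2)] by (simp add: w_def add_pos_pos)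
    have "R * (w j + w 1) \<le> 2 * S" using j jA by (auto simp: G_def bad_def)
    then have "R / (4 * S) \<le> 1 / (2 * (w j + w 1))"
      using S wpos by (simp add: field_simps)
    moreover have "D\<^sup>2 \<le> (\<mu> 1 - \<mu> j)\<^sup>2" using g gap_nonneg by (intro power_mono)
    ultimately have "D\<^sup>2 * (R / (4 * S)) \<le> (\<mu> 1 - \<mu> j)\<^sup>2 * (1 / (2 * (w j + w 1)))"
      using R S by (intro mult_mono) auto
    then have le: "exp (- ((\<mu> 1 - \<mu> j)\<^sup>2 / (2 * (w j + w 1)))) \<le> e"
      by (simp add: e_def)
    have "prob (E j) \<le> exp (- ((\<mu> 1 - \<mu> j)\<^sup>2 / (2 * (w j + w 1)))) / 2"
      unfolding E_def w_def using jA A g gap_nonneg Npos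
      by (intro normal_mean_comparison[OF indep] gauss sigma_pos) auto
    then show ?thesis using le by simp
  qed
  \<comment> \<open>Arm 1 may itself be in \<open>bad\<close>, but it never counts among the arms
    beating it.\<close>
  define b where "b = card (bad - {1})"
  have finbad: "finite bad" using fin by (simp add: bad_def)
  have b: "3 * b \<le> k" using bad card_mono[OF finbad, of "bad - {1}"] by (simp add: b_def)
  have cardG: "real (card G) = real k - 1 - b"
  proof -
    have "A = G \<union> insert 1 (bad - {1})" "G \<inter> insert 1 (bad - {1}) = {}"
      using A by (auto simp: G_def bad_def)
    then have "card A = card G + card (insert 1 (bad - {1}))"
      using fin finbad card_Un_disjoint[of G "insert 1 (bad - {1})"] by (simp add: G_def)
    moreover have "card (insert 1 (bad - {1})) = Suc b" using finbad by (simp add: b_def del: insert_Diff_single)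
    ultimately show ?thesis by (simp only: k_def)
  qed
  have setsE: "E j \<in> sets M" if "j \<in> G" for j
  proof -
    have "j \<in> {1..K}" "1 \<in> {1..K}" using that A by (auto simp: G_def)
    note this[THEN measurable_stage_mean, measurable]
    show ?thesis unfolding E_def by measurable
  qed
  have setF: "best_elim s A \<in> sets M" using sets_best_elim A by simp
  have pt: "(real k / 2 - b) * indicator (best_elim s A) \<omega> \<le> (\<Sum>j\<in>G. indicator (E j) \<omega>)" for \<omega>
  proof (cases "\<omega> \<in> best_elim s A")
    case True
    let ?v = "emp_mean X \<omega> s N"
    have "(k + 1) div 2 \<le> card {j \<in> A. ?v 1 < ?v j \<or> (?v j = ?v 1 \<and> j < 1)}"
      using True A by (simp add: best_elim_def keep_top_half_def k_def N_def)
    \<comment> \<open>An arm that beats arm 1 differs from it, so it is either discarded or in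
      \<open>G\<close> with \<open>E j\<close> occurring.\<close>
    also have "\<dots> \<le> card ({j \<in> G. \<omega> \<in> E j} \<union> (bad - {1}))"
      using True A fin finbad by (intro card_mono) (auto simp: G_def E_def best_elim_def)
    also have "\<dots> \<le> card {j \<in> G. \<omega> \<in> E j} + b"
      unfolding b_def by (rule card_Un_le)
    finally have "real k / 2 \<le> real (card {j \<in> G. \<omega> \<in> E j}) + b"
      using ev by (auto elim!: evenE simp: k_def)
    moreover have "real (card {j \<in> G. \<omega> \<in> E j}) = (\<Sum>j\<in>G. indicator (E j) \<omega>)"
      using fin card_filter_eq_sum[of G "\<lambda>j. \<omega> \<in> E j"]
      by (simp add: G_def indicator_def of_bool_def)
    ultimately show ?thesis using True by simp
  qed (simp add: sum_nonneg)
  have "(real k / 2 - b) * prob (best_elim s A) = (\<integral>\<omega>. (real k / 2 - b) * indicator (best_elim s A) \<omega> \<partial>M)"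
    using setF by simp
  also have "\<dots> \<le> (\<integral>\<omega>. (\<Sum>j\<in>G. indicator (E j) \<omega>) \<partial>M)"
    using setF setsE pt
    by (intro integral_mono) (auto intro!: Bochner_Integration.integrable_sum simp: integrable_indicator_iff emeasure_eq_measure)
  also have "\<dots> = (\<Sum>j\<in>G. prob (E j))"
    using setsE by (subst Bochner_Integration.integral_sum) (auto simp: emeasure_eq_measure)
  also have "\<dots> \<le> real (card G) * (e / 2)"
    using E_le by (rule sum_bounded_above)
  also have "\<dots> \<le> (real k / 2 - b) * (2 * e)"
  proof -
    \<comment> \<open>Equivalent to \<open>3 * b \<le> k + 1\<close>: the Gaussian factor 1/2 on the
      left pays for discarding a third of the arms.\<close>
    have "(real k - 1 - b) / 2 \<le> (real k / 2 - b) * 2" using b by simp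
    from mult_right_mono[OF this, of e] show ?thesis by (simp add: cardG e_def mult.assoc)
  qed
  finally have "prob (best_elim s A) \<le> 2 * e"
    using b k0 by (simp add: mult_le_cancel_left_pos)
  then show ?thesis by (simp add: e_def R_def k_def)
qed

text \<open>The active set depends on the rewards of earlier stages only.\<close>

lemma prob_active_best_elim:
  assumes A: "A \<subseteq> {1..K}"
  shows "prob ({\<omega> \<in> space M. active K L pick X \<omega> s = A} \<inter> best_elim s A)
    = prob {\<omega> \<in> space M. active K L pick X \<omega> s = A} * prob (best_elim s A)"
proof -
  define U where "U = {..<s} \<times> {1..K} \<times> (UNIV :: nat set)"
  define V where "V = {s} \<times> {1..K} \<times> (UNIV :: nat set)"
  let ?U = "\<lambda>\<omega>. \<lambda>p\<in>U. X p \<omega>" and ?V = "\<lambda>\<omega>. \<lambda>p\<in>V. X p \<omega>"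
  let ?PU = "PiM U (\<lambda>_. borel) :: (_ \<Rightarrow> real) measure"
  let ?PV = "PiM V (\<lambda>_. borel) :: (_ \<Rightarrow> real) measure"
  \<comment> \<open>Rewards as coordinate projections: both events become preimages of measurable
    sets under reward families with disjoint index sets \<open>U\<close> and
    \<open>V\<close>.\<close>
  let ?Y = "\<lambda>p f. f p"
  let ?N = "counts pick A L"
  define a where "a = {f \<in> space ?PU. active K L pick ?Y f s = A}"
  define b where "b = {f \<in> space ?PV. 1 \<notin> keep_top_half A (emp_mean ?Y f s ?N)}"
  have "a \<in> sets ?PU"
    unfolding a_def by (intro predE measurable_active_eq) (auto simp: U_def)
  have "Measurable.pred ?PV (\<lambda>f. 1 \<in> keep_top_half A (emp_mean ?Y f s ?N))"
    using A by (intro measurable_mem_keep_top_half measurable_emp_mean)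
      (auto simp: V_def intro: finite_subset)
  then have "b \<in> sets ?PV" unfolding b_def by measurable
  have "indep_var ?PU ?U ?PV ?V"
    by (rule indep_var_restrict[OF indep]) (auto simp: U_def V_def)
  from indep_varD[OF this \<open>a \<in> sets ?PU\<close> \<open>b \<in> sets ?PV\<close>]
  have *: "prob ((\<lambda>x. (?U x, ?V x)) -` (a \<times> b) \<inter> space M)
    = prob (?U -` a \<inter> space M) * prob (?V -` b \<inter> space M)" .
  have "active K L pick ?Y (?U \<omega>) s = active K L pick X \<omega> s" for \<omega>
    by (rule active_cong) (auto simp: U_def)
  then have a: "?U -` a \<inter> space M = {\<omega> \<in> space M. active K L pick X \<omega> s = A}"
    by (auto simp: a_def space_PiM)
  have "keep_top_half A (emp_mean ?Y (?V \<omega>) s ?N) = keep_top_half A (emp_mean X \<omega> s ?N)" for \<omega>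
    using A by (intro keep_top_half_cong) (auto simp: emp_mean_def V_def subset_iff)
  then have b: "?V -` b \<inter> space M = best_elim s A"
    by (auto simp: b_def space_PiM best_elim_def)
  have "(\<lambda>x. (?U x, ?V x)) -` (a \<times> b) \<inter> space M = (?U -` a \<inter> space M) \<inter> (?V -` b \<inter> space M)"
    by auto
  with * show ?thesis by (simp only: a b)
qed

text \<open>Split by the value of the active set: each piece factors by independence, the
  elimination bound is uniform in \<open>A\<close>, and the weights sum to at most 1.\<close>

lemma prob_best_lost_le:
  assumes K: "K = 2 ^ m" and s: "s < m"
  defines "lost \<equiv> {\<omega> \<in> space M. 1 \<in> active K L pick X \<omega> s \<and> 1 \<notin> active K L pick X \<omega> (Suc s)}"
  shows "lost \<in> sets M"
    and "prob lost \<le> 2 * exp (- (D\<^sup>2 / (4 * S) * (L / K - 2/3)))"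
proof -
  define C where "C = {A. A \<subseteq> {1..K} \<and> 1 \<in> A \<and> card A = 2 ^ (m - s)}"
  let ?at = "\<lambda>A. {\<omega> \<in> space M. active K L pick X \<omega> s = A}"
  let ?c = "2 * exp (- (D\<^sup>2 / (4 * S) * (L / K - 2/3)))"
  have finC: "finite C" unfolding C_def by (rule finite_subset[of _ "Pow {1..K}"]) auto
  have at: "?at A \<in> sets M" for A
    by (intro predE measurable_active_eq measurable_reward)
  have S: "0 \<le> S" using order_trans[OF zero_le_power2 var_le[of 1]] K by simp
  have lost_eq: "lost = (\<Union>A\<in>C. ?at A \<inter> best_elim s A)"
    using active_subset[of K L pick X _ s] card_active[OF K, of s L pick X] s
    by (auto simp: lost_def C_def best_elim_def Let_def)
  have sets: "?at A \<inter> best_elim s A \<in> sets M" if "A \<in> C" for A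
    using that at sets_best_elim[of A] by (auto simp: C_def)
  then show "lost \<in> sets M" unfolding lost_eq using finC by auto
  have el: "prob (best_elim s A) \<le> ?c" if "A \<in> C" for A
  proof -
    have A: "A \<subseteq> {1..K}" "1 \<in> A" "card A = 2 ^ (m - s)" using that by (auto simp: C_def)
    have "card A \<le> K" "0 < card A" using card_mono[OF _ A(1)] A(3) by auto
    \<comment> \<open>Later stages spread the same budget over fewer arms, so the first stage is the
      worst.\<close>
    then have "L / K \<le> L / card A" by (intro divide_left_mono) auto
    then have "D\<^sup>2 / (4 * S) * (L / K - 2/3) \<le> D\<^sup>2 / (4 * S) * (L / card A - 2/3)"
      using S by (intro mult_left_mono) auto
    moreover have "even (card A)" using A(3) s by simp
    ultimately show ?thesis by (intro order_trans[OF prob_best_elim_le[OF A(1,2)]]) simp_all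
  qed
  have "prob lost \<le> (\<Sum>A\<in>C. prob (?at A \<inter> best_elim s A))"
    unfolding lost_eq using sets finC by (intro finite_measure_subadditive_finite) auto
  also have "\<dots> \<le> (\<Sum>A\<in>C. prob (?at A) * ?c)"
    using prob_active_best_elim el by (intro sum_mono) (auto simp: C_def intro!: mult_left_mono)
  also have "\<dots> = (\<Sum>A\<in>C. prob (?at A)) * ?c" by (simp add: sum_distrib_right)
  also have "(\<Sum>A\<in>C. prob (?at A)) = prob (\<Union>A\<in>C. ?at A)"
    using finC at by (intro finite_measure_finite_Union[symmetric]) (auto simp: disjoint_family_on_def)
  also have "\<dots> * ?c \<le> 1 * ?c" by (intro mult_right_mono) auto
  finally show "prob lost \<le> ?c" by simp
qed

text \<open>Union bound over the stage in which arm 1 is lost.\<close>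

lemma prob_best_not_active_le:
  assumes K: "K = 2 ^ m" and s: "s \<le> m"
  shows "prob {\<omega> \<in> space M. 1 \<notin> active K L pick X \<omega> s}
    \<le> real s * (2 * exp (- (D\<^sup>2 / (4 * S) * (L / K - 2/3))))"
  using s
proof (induction s)
  case 0
  then show ?case using K by simp
next
  case (Suc s)
  let ?out = "\<lambda>s. {\<omega> \<in> space M. 1 \<notin> active K L pick X \<omega> s}"
  let ?lost = "{\<omega> \<in> space M. 1 \<in> active K L pick X \<omega> s \<and> 1 \<notin> active K L pick X \<omega> (Suc s)}"
  note measurable_mem_active[of K X M, OF measurable_reward, measurable]
  have out: "?out s \<in> sets M" by measurable
  note lost = prob_best_lost_le[OF K, of s]
  have "prob (?out (Suc s)) \<le> prob (?out s \<union> ?lost)"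
    using out lost Suc.prems by (intro finite_measure_mono) auto
  also have "\<dots> \<le> prob (?out s) + prob ?lost"
    using out lost Suc.prems by (intro measure_Un_le) auto
  finally show ?case using Suc lost(2) by (simp add: algebra_simps)
qed

end

theorem theorem2:
  fixes M :: "'a measure"
    and X :: "nat \<times> nat \<times> nat \<Rightarrow> 'a \<Rightarrow> real"
    and K m n :: nat
    and \<mu> \<sigma> :: "nat \<Rightarrow> real"
    and pick :: "nat set \<Rightarrow> (nat \<Rightarrow> nat) \<Rightarrow> nat"
  assumes "prob_space M"
    and indep: "prob_space.indep_vars M (\<lambda>_. borel) X (UNIV \<times> {1..K} \<times> UNIV)"
    and gauss: "\<And>s i j. i \<in> {1..K} \<Longrightarrow>
                  distributed M lborel (X (s, i, j)) (normal_density (\<mu> i) (\<sigma> i))"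
    and sigma_pos: "\<And>i. i \<in> {1..K} \<Longrightarrow> \<sigma> i > 0"
    and K_pow: "K = 2 ^ m" and K_ge: "K \<ge> 2"
    and n_div: "m dvd n"
    and well_def: "K \<le> n div m"
    and best: "\<mu> 1 > \<mu> 2"
    and sorted: "\<And>i j. 2 \<le> i \<Longrightarrow> i \<le> j \<Longrightarrow> j \<le> K \<Longrightarrow> \<mu> j \<le> \<mu> i"
    and rule: "shvar_rule \<sigma> pick"
  shows "measure M {\<omega> \<in> space M. sh_output K m n pick X \<omega> \<noteq> 1}
         \<le> 2 * real m *
            exp (- ((real n - real K * ln (real K)) * (\<mu> 1 - \<mu> 2) ^ 2
                   / (4 * Max ((\<lambda>i. \<sigma> i ^ 2) ` {1..K}) * real K * real m)))"
proof -
  define S where "S = Max ((\<lambda>i. \<sigma> i ^ 2) ` {1..K})"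
  define L where "L = n div m"
  define D where "D = \<mu> 1 - \<mu> 2"
  interpret prob_space M by fact
  interpret shvar_bandit M X K L \<mu> \<sigma> S D pick
  proof
    show "(\<sigma> i)\<^sup>2 \<le> S" if "i \<in> {1..K}" for i
      unfolding S_def using that by (intro Max_ge) auto
    show "\<mu> i + D \<le> \<mu> 1" if "i \<in> {2..K}" for i
      using sorted[of 2 i] that by (simp add: D_def)
  qed (use indep gauss sigma_pos well_def best rule in \<open>auto simp: L_def D_def\<close>)
  have m: "0 < m" using K_pow K_ge by (cases m) auto
  have n: "real n = real m * real L" using n_div by (auto simp: L_def)
  have S: "0 < S" using less_le_trans[OF zero_less_power[OF sigma_pos[of 1]] var_le[of 1]] K_ge by simp
  note measurable_mem_active[of K X M, OF measurable_reward, measurable]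
  have out: "{\<omega> \<in> space M. 1 \<notin> active K L pick X \<omega> m} \<in> sets M" by measurable
  \<comment> \<open>After \<open>m\<close> exact halvings a single arm is left, so a wrong output
    means that arm 1 was eliminated.\<close>
  have "the_elem (active K L pick X \<omega> m) = 1" if "1 \<in> active K L pick X \<omega> m" for \<omega>
  proof -
    have "card (active K L pick X \<omega> m) = 1" using card_active[OF K_pow, of m] by simp
    then show ?thesis using that by (auto simp: card_1_singleton_iff)
  qed
  then have "prob {\<omega> \<in> space M. sh_output K m n pick X \<omega> \<noteq> 1}
      \<le> prob {\<omega> \<in> space M. 1 \<notin> active K L pick X \<omega> m}"
    using out by (intro finite_measure_mono) (auto simp: sh_output_def L_def)
  also have "\<dots> \<le> real m * (2 * exp (- (D\<^sup>2 / (4 * S) * (L / K - 2/3))))"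
    by (rule prob_best_not_active_le[OF K_pow]) simp
  also have "\<dots> \<le> real m * (2 * exp (- (D\<^sup>2 / (4 * S) * (L / K - ln 2))))"
  proof -
    have "D\<^sup>2 / (4 * S) * (L / K - ln 2) \<le> D\<^sup>2 / (4 * S) * (L / K - 2/3)"
      using S ln2_ge_two_thirds by (intro mult_left_mono) auto
    then show ?thesis by (simp add: mult_left_mono)
  qed
  also have "D\<^sup>2 / (4 * S) * (L / K - ln 2) = (real n - real K * ln (real K)) * D\<^sup>2 / (4 * S * K * m)"
  proof -
    \<comment> \<open>Together with \<open>n = m * L\<close>, this cancels the number of stages in
      the exponent.\<close>
    have "ln (real K) = m * ln 2" by (simp add: K_pow ln_realpow)
    then show ?thesis using m S K_ge by (simp add: n field_simps)
  qed
  finally show ?thesis by (simp add: S_def D_def mult.assoc)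
qed

end
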